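(* Let $U:\mathbb{R}^l\to\mathbb{R}$ be convex, let $\Sigma=\{\mathbf{w}\in\mathbb{R}^l: U(\mathbf{w})\le 0\}$ and $\Sigma_0=\{\mathbf{w}\in\mathbb{R}^l: U(\mathbf{w})<0\}$. Let $K\subset\mathbb{R}^d$ be a bounded domain, let $\mathbf{w}:K\to\mathbb{R}^l$ be a smooth function with $\mathbf{w}(x)\in\Sigma$ for all $x\in K$, and let $\mathbf{w}_h$ be a vector polynomial on $K$ (an approximation of $\mathbf{w}$) which is not entirely located in $\Sigma$, with average $\bar{\mathbf{w}}_h=\frac1{|K|}\int_K\mathbf{w}_h(x)\,dx$. Assume $\bar{\mathbf{w}}_h\in\Sigma_0$. Define $$\tilde{\mathbf{w}}_h(x)=\theta\,\mathbf{w}_h(x)+(1-\theta)\,\bar{\mathbf{w}}_h,\qquad \theta=\min\left\{1,\ \frac{U(\bar{\mathbf{w}}_h)}{U(\bar{\mathbf{w}}_h)-U_h^{\max}}\right\},\qquad U_h^{\max}=\max_{x\in K}U(\mathbf{w}_h(x))>0 .$$ Then $\tilde{\mathbf{w}}_h(x)\in\Sigma$ for all $x\in K$. Moreover, there is a constant $C>0$, depending on $\mathbf{w}$ and $\Sigma$ (the latter through the function $U$) but not on $\mathbf{w}_h$, such that if $\|\mathbf{w}_h-\mathbf{w}\|_\infty\le 1$, then $$\|\tilde{\mathbf{w}}_h-\mathbf{w}\|_\infty\le \frac{C}{|U(\bar{\mathbf{w}}_h)|}\,\|\mathbf{w}_h-\mathbf{w}\|_\infty .$$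
   Context: $\|\cdot\|_\infty$ denotes the maximum (supremum) norm over $x\in K$. The maximum defining $U_h^{\max}$ is understood as a supremum if $K$ is not closed. *)

theory Defs
  imports "HOL-Analysis.Analysis"
begin

(* A domain is a nonempty connected open set; since K may or may not be closed, K is allowed to
   contain any part of the boundary of such a set (both the open set itself and its closure
   qualify).  Measurability of K is needed only because that boundary may have positive measure. *)
definition bounded_domain :: "'a::euclidean_space set \<Rightarrow> bool" where
  "bounded_domain K \<longleftrightarrow>
     bounded K \<and> K \<in> sets lebesgue \<and>
     (\<exists>G. open G \<and> connected G \<and> G \<noteq> {} \<and> G \<subseteq> K \<and> K \<subseteq> closure G)"

(* Intended for open S, where this is the class C^k(S). *)
primrec Ck_on ::
  "nat \<Rightarrow> ('a::euclidean_space \<Rightarrow> 'b::euclidean_space) \<Rightarrow> 'a set \<Rightarrow> bool" where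
  "Ck_on 0 f S \<longleftrightarrow> continuous_on S f"
| "Ck_on (Suc k) f S \<longleftrightarrow>
     (\<forall>x\<in>S. f differentiable (at x)) \<and>
     (\<forall>v. Ck_on k (\<lambda>x. frechet_derivative f (at x) v) S)"

(* Smoothness on an arbitrary set: existence of a C-infinity extension to an open neighbourhood.
   For open K one may take S = K, and this is the usual notion; no bound on f or its
   derivatives is implied then. *)
definition smooth_on :: "'a::euclidean_space set \<Rightarrow> ('a \<Rightarrow> 'b::euclidean_space) \<Rightarrow> bool" where
  "smooth_on K f \<longleftrightarrow>
     (\<exists>S g. open S \<and> K \<subseteq> S \<and> (\<forall>k. Ck_on k g S) \<and> (\<forall>x\<in>K. g x = f x))"

(* Extended-valued, so that it is infinite (rather than unspecified) for unbounded f. *)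
definition sup_norm_on :: "'a set \<Rightarrow> ('a \<Rightarrow> 'b::real_normed_vector) \<Rightarrow> ennreal" where
  "sup_norm_on K f = (SUP x\<in>K. ennreal (norm (f x)))"

definition sublevel :: "('b \<Rightarrow> real) \<Rightarrow> 'b set" where
  "sublevel U = {w. U w \<le> 0}"

definition strict_sublevel :: "('b \<Rightarrow> real) \<Rightarrow> 'b set" where
  "strict_sublevel U = {w. U w < 0}"

definition average_on ::
  "'a::euclidean_space set \<Rightarrow> ('a \<Rightarrow> 'b::euclidean_space) \<Rightarrow> 'b" where
  "average_on K f = (1 / measure lebesgue K) *\<^sub>R (LINT x:K|lebesgue. f x)"

(* A real supremum: for convex U on a Euclidean space, bounded K and polynomial wh, the values
   U (wh x) are bounded on K; the supremum is a maximum if K is closed. *)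
definition U_max :: "('b \<Rightarrow> real) \<Rightarrow> 'a set \<Rightarrow> ('a \<Rightarrow> 'b) \<Rightarrow> real" where
  "U_max U K wh = (SUP x\<in>K. U (wh x))"

definition limiter_theta ::
  "('b::euclidean_space \<Rightarrow> real) \<Rightarrow> 'a::euclidean_space set \<Rightarrow> ('a \<Rightarrow> 'b) \<Rightarrow> real" where
  "limiter_theta U K wh =
     min 1 (U (average_on K wh) / (U (average_on K wh) - U_max U K wh))"

definition limited ::
  "('b::euclidean_space \<Rightarrow> real) \<Rightarrow> 'a::euclidean_space set \<Rightarrow> ('a \<Rightarrow> 'b) \<Rightarrow> 'a \<Rightarrow> 'b" where
  "limited U K wh x =
     limiter_theta U K wh *\<^sub>R wh x + (1 - limiter_theta U K wh) *\<^sub>R average_on K wh"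

end

theory Submission
  imports Defs
begin

text \<open>The maximum principle is convexity of \<open>U\<close> along the segment from the average to \<open>wh x\<close>.
  For the error estimate, \<open>w\<close> may be assumed bounded: otherwise no polynomial is within
  finite distance of it. A convex function is Lipschitz on balls, so \<open>U \<circ> w \<le> 0\<close> bounds
  \<open>U_max\<close> by a multiple of the error \<open>e\<close>, and \<open>1 - \<theta> \<le> U_max / \<bar>U avg\<bar>\<close> gives
  \<open>norm (limited - w) \<le> e + (1 - \<theta>) * norm (avg - wh) = O(e / \<bar>U avg\<bar>)\<close>.\<close>

text \<open>Prolonging the segment from \<open>x\<close> to \<open>y\<close> by a unit beyond
  \<open>y\<close> stays in the larger ball, so convexity bounds the increment by the oscillation of
  \<open>f\<close>, at most \<open>2 * B\<close>, times the weight of the new endpoint. Exchanging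
  \<open>x\<close> and \<open>y\<close> gives Lipschitz constant \<open>2 * B\<close> on the smaller
  ball.\<close>

lemma convex_on_bounded_imp_lipschitz_cball:
  fixes f :: "'a::real_normed_vector \<Rightarrow> real"
  assumes "convex_on (cball a (r + 1)) f"
    and bound: "\<And>x. x \<in> cball a (r + 1) \<Longrightarrow> \<bar>f x\<bar> \<le> B"
    and x: "x \<in> cball a r" and y: "y \<in> cball a r"
  shows "f y \<le> f x + 2 * B * norm (y - x)"
proof (cases "x = y")
  case False
  define d where "d = norm (y - x)"
  define z where "z = y + (1 / d) *\<^sub>R (y - x)"
  \<comment> \<open>Since \<open>z\<close> lies at distance \<open>1 + d\<close> from
    \<open>x\<close>, this is the weight for which \<open>y\<close> is
    \<open>(1 - t) *\<^sub>R x + t *\<^sub>R z\<close>.\<close>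
  define t where "t = d / (1 + d)"
  have d: "d > 0"
    using False by (simp add: d_def)
  have t: "0 \<le> t" "t \<le> 1" "t \<le> d"
    using d by (auto simp: t_def field_simps)
  have "dist y z = 1"
    using d by (simp add: z_def dist_norm) (simp add: d_def)
  then have z: "z \<in> cball a (r + 1)"
    using y dist_triangle[of a z y] by simp
  have x': "x \<in> cball a (r + 1)"
    using x by simp
  have coeffs: "1 - t = 1 / (1 + d)" "t * (1 / d) = 1 / (1 + d)"
    using d by (simp_all add: t_def field_simps)
  have "(1 - t) *\<^sub>R x + t *\<^sub>R z = (1 - t) *\<^sub>R x + t *\<^sub>R y + (t * (1 / d)) *\<^sub>R (y - x)"
    by (simp add: z_def scaleR_right_distrib)
  also have "\<dots> = (1 - t) *\<^sub>R x + t *\<^sub>R y + (1 - t) *\<^sub>R (y - x)"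
    by (simp only: coeffs)
  also have "\<dots> = y"
    by (simp add: algebra_simps)
  finally have "f y \<le> (1 - t) * f x + t * f z"
    using convex_onD[OF assms(1) t(1,2) x' z] by simp
  also have "\<dots> = f x + t * (f z - f x)"
    by (simp add: algebra_simps)
  also have "t * (f z - f x) \<le> t * (2 * B)"
    using bound[OF x'] bound[OF z] t(1) by (intro mult_left_mono) auto
  also have "\<dots> \<le> d * (2 * B)"
    using bound[OF x'] t(3) by (intro mult_right_mono) auto
  finally show ?thesis
    by (simp add: d_def mult.commute)
qed simp

section \<open>Bounds for averages and for images of bounded sets\<close>

lemma norm_average_on_le:
  assumes "K \<in> lmeasurable" "0 \<le> R" and bound: "\<And>x. x \<in> K \<Longrightarrow> norm (f x) \<le> R"
  shows "norm (average_on K f) \<le> R"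
proof -
  have "integrable lebesgue (indicat_real K)"
    using assms(1) by (simp add: lmeasurable_iff_integrable)
  then have "integrable lebesgue (\<lambda>x. indicat_real K x * R)"
    by (rule integrable_mult_left)
  moreover have "norm (LINT x:K|lebesgue. f x) \<le> (LINT x|lebesgue. norm (indicator K x *\<^sub>R f x))"
    unfolding set_lebesgue_integral_def by (rule integral_norm_bound)
  \<comment> \<open>Integrability of the majorant suffices: a non-integrable integrand has integral
    0 by convention.\<close>
  moreover have "(LINT x|lebesgue. norm (indicator K x *\<^sub>R f x)) \<le> (LINT x|lebesgue. indicator K x * R)"
    using calculation(1) assms(2) bound by (intro integral_mono') (auto simp: indicator_def)
  ultimately have int: "norm (LINT x:K|lebesgue. f x) \<le> measure lebesgue K * R"
    by simp
  show ?thesis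
  proof (cases "measure lebesgue K = 0")
    \<comment> \<open>Division by zero makes the average 0 here.\<close>
    case True
    then show ?thesis
      using assms(2) by (simp add: average_on_def)
  next
    case False
    then have "0 < measure lebesgue K"
      by (simp add: zero_less_measure_iff)
    then show ?thesis
      using int by (simp add: average_on_def field_simps)
  qed
qed

lemma bounded_image_polynomial_function:
  fixes p :: "'a::euclidean_space \<Rightarrow> 'b::euclidean_space"
  assumes "polynomial_function p" "bounded K"
  shows "bounded (p ` K)"
proof -
  have "compact (p ` closure K)"
    using assms by (intro compact_continuous_image continuous_on_polymonial_function) auto
  then show ?thesis
    by (meson bounded_subset closure_subset compact_imp_bounded image_mono)
qed

lemma convex_on_bounded_image:
  fixes U :: "'a::euclidean_space \<Rightarrow> real"
  assumes "convex_on UNIV U" "bounded S"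
  shows "bounded (U ` S)"
proof -
  have "continuous_on UNIV U"
    using assms(1) by (intro convex_on_continuous) auto
  then have "compact (U ` closure S)"
    using assms(2) by (intro compact_continuous_image) (auto intro: continuous_on_subset)
  then show ?thesis
    by (meson bounded_subset closure_subset compact_imp_bounded image_mono)
qed

section \<open>The limiter and its maximum principle\<close>

lemma U_max_upper:
  assumes "bdd_above ((\<lambda>x. U (wh x)) ` K)" "x \<in> K"
  shows "U (wh x) \<le> U_max U K wh"
  unfolding U_max_def using assms(2,1) by (rule cSUP_upper)

lemma U_max_pos:
  assumes "bdd_above ((\<lambda>x. U (wh x)) ` K)" "\<not> wh ` K \<subseteq> sublevel U"
  shows "0 < U_max U K wh"
proof -
  obtain x where "x \<in> K" "0 < U (wh x)"
    using assms(2) by (force simp: sublevel_def)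
  then show ?thesis
    using U_max_upper[of U wh K x] assms(1) by fastforce
qed

text \<open>Numerator and denominator are both negative and the denominator is larger in modulus, so
  the quotient lies below 1 and the minimum selects it.\<close>

lemma limiter_theta_eq:
  assumes "0 < U_max U K wh" "average_on K wh \<in> strict_sublevel U"
  shows "limiter_theta U K wh = U (average_on K wh) / (U (average_on K wh) - U_max U K wh)"
  using assms by (simp add: limiter_theta_def strict_sublevel_def divide_simps min_def)

lemma limited_in_sublevel:
  assumes "convex_on UNIV U" and bdd: "bdd_above ((\<lambda>x. U (wh x)) ` K)"
    and pos: "0 < U_max U K wh" and neg: "average_on K wh \<in> strict_sublevel U" and "x \<in> K"
  shows "limited U K wh x \<in> sublevel U"
proof -
  define t where "t = limiter_theta U K wh"
  let ?a = "average_on K wh"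
  have t_eq: "t = U ?a / (U ?a - U_max U K wh)"
    using limiter_theta_eq[OF pos neg] by (simp add: t_def)
  have neg': "U ?a < 0"
    using neg by (simp add: strict_sublevel_def)
  have t: "0 \<le> t" "t \<le> 1"
    using neg' pos by (auto simp: t_eq divide_simps)
  have "limited U K wh x = (1 - t) *\<^sub>R ?a + t *\<^sub>R wh x"
    by (simp add: limited_def t_def)
  then have "U (limited U K wh x) \<le> (1 - t) * U ?a + t * U (wh x)"
    using convex_onD[OF assms(1) t] by simp
  also have "\<dots> \<le> (1 - t) * U ?a + t * U_max U K wh"
    using U_max_upper[of U wh K x] bdd \<open>x \<in> K\<close> t by (simp add: mult_left_mono)
  \<comment> \<open>The weight \<open>t\<close> is exactly the zero of this affine expression, which
    is where the formula for \<theta> comes from.\<close>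
  also have "\<dots> = 0"
    using neg' pos by (simp add: t_eq field_simps)
  finally show ?thesis
    by (simp add: sublevel_def)
qed

lemma norm_limited_diff_le:
  assumes pos: "0 < U_max U K wh" and neg: "average_on K wh \<in> strict_sublevel U"
  shows "norm (limited U K wh x - v)
    \<le> norm (wh x - v) + U_max U K wh / \<bar>U (average_on K wh)\<bar> * norm (average_on K wh - wh x)"
proof -
  define t where "t = limiter_theta U K wh"
  let ?a = "average_on K wh"
  have t_eq: "t = U ?a / (U ?a - U_max U K wh)"
    using limiter_theta_eq[OF pos neg] by (simp add: t_def)
  have neg': "U ?a < 0"
    using neg by (simp add: strict_sublevel_def)
  have one_minus_t: "1 - t = U_max U K wh / (U_max U K wh + \<bar>U ?a\<bar>)"
    using neg' pos by (simp add: t_eq field_simps)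
  \<comment> \<open>Dropping the positive \<open>U_max U K wh\<close> from the denominator enlarges
    the fraction.\<close>
  have t: "0 \<le> 1 - t" "1 - t \<le> U_max U K wh / \<bar>U ?a\<bar>"
    unfolding one_minus_t using neg' pos
    by (intro divide_nonneg_pos divide_left_mono mult_pos_pos; linarith)+
  have "limited U K wh x - v = (wh x - v) + (1 - t) *\<^sub>R (?a - wh x)"
    by (simp add: limited_def t_def algebra_simps)
  then have "norm (limited U K wh x - v) \<le> norm (wh x - v) + (1 - t) * norm (?a - wh x)"
    using t(1) by (metis abs_of_nonneg norm_scaleR norm_triangle_ineq)
  also have "\<dots> \<le> norm (wh x - v) + U_max U K wh / \<bar>U ?a\<bar> * norm (?a - wh x)"
    using t(2) by (intro add_left_mono mult_right_mono norm_ge_zero)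
  finally show ?thesis .
qed

text \<open>A bound by 1 makes the extended supremum finite, so the estimates can be carried out
  with a real error \<open>e\<close>.\<close>

lemma sup_norm_on_le_1E:
  assumes "sup_norm_on K f \<le> 1"
  obtains e where "0 \<le> e" "e \<le> 1" "sup_norm_on K f = ennreal e" "\<And>x. x \<in> K \<Longrightarrow> norm (f x) \<le> e"
proof (rule that)
  define e where "e = enn2real (sup_norm_on K f)"
  have fin: "sup_norm_on K f < top"
    using assms by (simp add: order_le_less_trans)
  then show eq: "sup_norm_on K f = ennreal e"
    by (simp add: e_def)
  show e0: "0 \<le> e"
    by (simp add: e_def)
  show "e \<le> 1"
    using assms e0 unfolding eq by (simp add: ennreal_le_1)
  show "norm (f x) \<le> e" if "x \<in> K" for x
  proof -
    have "ennreal (norm (f x)) \<le> ennreal e"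
      using that unfolding eq[symmetric] sup_norm_on_def by (rule SUP_upper)
    then show ?thesis
      using e0 by (simp add: ennreal_le_iff)
  qed
qed

lemma sup_norm_on_leI:
  assumes "\<And>x. x \<in> K \<Longrightarrow> norm (f x) \<le> B"
  shows "sup_norm_on K f \<le> ennreal B"
  unfolding sup_norm_on_def using assms by (intro SUP_least ennreal_leI)

text \<open>The radii grow by one twice: \<open>w\<close> stays in the ball of radius
  \<open>M\<close>, \<open>wh\<close> and its average in that of radius \<open>M + 1\<close> because
  \<open>e \<le> 1\<close>, and the Lipschitz estimate needs a further unit, whence
  \<open>M + 2\<close>. In the constant, \<open>B\<close> pays for the original error and
  \<open>2 * B * (2 * (M + 1))\<close> for the shift towards the average.\<close>

lemma limited_error_bound:
  fixes U :: "'b::euclidean_space \<Rightarrow> real" and K :: "'a::euclidean_space set"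
  assumes conv: "convex_on UNIV U" and K: "K \<in> lmeasurable"
    and wM: "\<And>x. x \<in> K \<Longrightarrow> norm (w x) \<le> M" and "0 \<le> M"
    and w: "\<And>x. x \<in> K \<Longrightarrow> U (w x) \<le> 0"
    and UB: "\<And>v. v \<in> cball 0 (M + 2) \<Longrightarrow> \<bar>U v\<bar> \<le> B"
    and pos: "0 < U_max U K wh" and neg: "average_on K wh \<in> strict_sublevel U"
    and e: "e \<le> 1" "\<And>x. x \<in> K \<Longrightarrow> norm (wh x - w x) \<le> e"
    and "x \<in> K"
  shows "norm (limited U K wh x - w x)
    \<le> (B + 2 * B * (2 * (M + 1))) / \<bar>U (average_on K wh)\<bar> * e"
proof -
  let ?a = "average_on K wh"
  have e0: "0 \<le> e"
    using e(2)[OF \<open>x \<in> K\<close>] norm_ge_zero order_trans by blast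
  have B0: "0 \<le> B"
    using UB[of 0] \<open>0 \<le> M\<close> by simp
  have a_neg: "U ?a < 0"
    using neg by (simp add: strict_sublevel_def)
  have wh_le: "norm (wh y) \<le> M + 1" if "y \<in> K" for y
    using norm_triangle_sub[of "wh y" "w y"] wM[OF that] e(1) e(2)[OF that] by linarith
  have a_le: "norm ?a \<le> M + 1"
    using K \<open>0 \<le> M\<close> wh_le by (intro norm_average_on_le) auto
  have U_max_le: "U_max U K wh \<le> 2 * B * e"
    unfolding U_max_def
  proof (rule cSUP_least)
    show "K \<noteq> {}"
      using \<open>x \<in> K\<close> by auto
    fix y assume y: "y \<in> K"
    \<comment> \<open>Comparison with \<open>w y\<close>, where \<open>U\<close> is nonpositive,
      makes the overshoot of \<open>U\<close> linear in the error.\<close>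
    have "U (wh y) \<le> U (w y) + 2 * B * norm (wh y - w y)"
    proof (rule convex_on_bounded_imp_lipschitz_cball[where a = 0 and r = "M + 1"])
      show "convex_on (cball 0 (M + 1 + 1)) U"
        using conv by (rule convex_on_subset) auto
    qed (use UB wh_le[OF y] wM[OF y] in auto)
    also have "\<dots> \<le> 0 + 2 * B * e"
      using w[OF y] e(2)[OF y] B0 by (intro add_mono mult_left_mono) auto
    finally show "U (wh y) \<le> 2 * B * e"
      by simp
  qed
  have "norm (?a - wh x) \<le> 2 * (M + 1)"
    using norm_triangle_ineq4[of ?a "wh x"] a_le wh_le[OF \<open>x \<in> K\<close>]
    by (simp add: algebra_simps)
  then have "U_max U K wh / \<bar>U ?a\<bar> * norm (?a - wh x) \<le> 2 * B * e / \<bar>U ?a\<bar> * (2 * (M + 1))"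
    using U_max_le pos \<open>0 \<le> M\<close> B0 e0 by (intro mult_mono divide_right_mono) auto
  \<comment> \<open>The plain error is given the same denominator: the average lies in the ball
    where \<open>B\<close> bounds \<open>U\<close>, so the factor is at least 1.\<close>
  moreover have "norm (wh x - w x) \<le> B / \<bar>U ?a\<bar> * e"
  proof -
    have "\<bar>U ?a\<bar> \<le> B"
      using a_le by (intro UB) auto
    then have "1 * e \<le> B / \<bar>U ?a\<bar> * e"
      using a_neg e0 by (intro mult_right_mono) (auto simp: field_simps)
    then show ?thesis
      using e(2)[OF \<open>x \<in> K\<close>] by simp
  qed
  ultimately have "norm (limited U K wh x - w x)
      \<le> B / \<bar>U ?a\<bar> * e + 2 * B * e / \<bar>U ?a\<bar> * (2 * (M + 1))"
    using norm_limited_diff_le[OF pos neg, of x "w x"] by linarith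
  also have "\<dots> = (B + 2 * B * (2 * (M + 1))) / \<bar>U ?a\<bar> * e"
    by (simp add: add_divide_distrib algebra_simps)
  finally show ?thesis .
qed

theorem theorem2p2:
  fixes U :: "real ^ 'l \<Rightarrow> real"
    and K :: "(real ^ 'd) set"
    and w :: "real ^ 'd \<Rightarrow> real ^ 'l"
  assumes "convex_on UNIV U"
    and "bounded_domain K"
    and "smooth_on K w"
    and "\<forall>x\<in>K. w x \<in> sublevel U"
  shows "(\<forall>wh :: real ^ 'd \<Rightarrow> real ^ 'l.
            polynomial_function wh \<longrightarrow>
            \<not> wh ` K \<subseteq> sublevel U \<longrightarrow>
            average_on K wh \<in> strict_sublevel U \<longrightarrow>
              0 < U_max U K wh \<and>
              (\<forall>x\<in>K. limited U K wh x \<in> sublevel U))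
       \<and> (\<exists>C::real. 0 < C \<and>
           (\<forall>wh :: real ^ 'd \<Rightarrow> real ^ 'l.
              polynomial_function wh \<longrightarrow>
              \<not> wh ` K \<subseteq> sublevel U \<longrightarrow>
              average_on K wh \<in> strict_sublevel U \<longrightarrow>
              sup_norm_on K (\<lambda>x. wh x - w x) \<le> 1 \<longrightarrow>
                sup_norm_on K (\<lambda>x. limited U K wh x - w x)
                  \<le> ennreal (C / \<bar>U (average_on K wh)\<bar>) * sup_norm_on K (\<lambda>x. wh x - w x)))"
proof -
  note conv = \<open>convex_on UNIV U\<close>
  have bK: "bounded K" and "K \<in> sets lebesgue"
    using assms(2) by (auto simp: bounded_domain_def)
  then have K: "K \<in> lmeasurable"
    by (rule bounded_set_imp_lmeasurable)
  \<comment> \<open>Ensures that the real supremum in \<open>U_max\<close> is a genuine least upper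
    bound.\<close>
  have bdd: "bdd_above ((\<lambda>x. U (wh x)) ` K)" if "polynomial_function wh" for wh
    using convex_on_bounded_image[OF conv bounded_image_polynomial_function[OF that bK]]
    by (simp add: image_image bounded_imp_bdd_above)
  show ?thesis
  proof (intro conjI allI impI ballI)
    fix wh :: "real ^ 'd \<Rightarrow> real ^ 'l"
    assume wh: "polynomial_function wh" "\<not> wh ` K \<subseteq> sublevel U"
      and neg: "average_on K wh \<in> strict_sublevel U"
    show pos: "0 < U_max U K wh"
      by (rule U_max_pos[OF bdd[OF wh(1)] wh(2)])
    show "limited U K wh x \<in> sublevel U" if "x \<in> K" for x
      by (rule limited_in_sublevel[OF conv bdd[OF wh(1)] pos neg that])
  next
    show "\<exists>C::real. 0 < C \<and>
           (\<forall>wh :: real ^ 'd \<Rightarrow> real ^ 'l.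
              polynomial_function wh \<longrightarrow>
              \<not> wh ` K \<subseteq> sublevel U \<longrightarrow>
              average_on K wh \<in> strict_sublevel U \<longrightarrow>
              sup_norm_on K (\<lambda>x. wh x - w x) \<le> 1 \<longrightarrow>
                sup_norm_on K (\<lambda>x. limited U K wh x - w x)
                  \<le> ennreal (C / \<bar>U (average_on K wh)\<bar>) * sup_norm_on K (\<lambda>x. wh x - w x))"
    proof (cases "bounded (w ` K)")
      case True
      then obtain M where M: "0 < M" "\<And>x. x \<in> K \<Longrightarrow> norm (w x) \<le> M"
        by (auto simp: bounded_pos)
      obtain B where B: "0 < B" "\<And>v. v \<in> cball 0 (M + 2) \<Longrightarrow> \<bar>U v\<bar> \<le> B"
        using convex_on_bounded_image[OF conv bounded_cball[of 0 "M + 2"]]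
        by (auto simp: bounded_pos)
      \<comment> \<open>\<open>M\<close> comes from \<open>w\<close> on \<open>K\<close> and
        \<open>B\<close> from \<open>U\<close> and \<open>M\<close>, so \<open>C\<close> is fixed
        before \<open>wh\<close> is chosen.\<close>
      define C where "C = B + 2 * B * (2 * (M + 1))"
      have "0 < C"
        using B(1) M(1) by (simp add: C_def add_pos_pos)
      moreover have "sup_norm_on K (\<lambda>x. limited U K wh x - w x)
          \<le> ennreal (C / \<bar>U (average_on K wh)\<bar>) * sup_norm_on K (\<lambda>x. wh x - w x)"
        if wh: "polynomial_function wh" "\<not> wh ` K \<subseteq> sublevel U"
          and neg: "average_on K wh \<in> strict_sublevel U"
          and le1: "sup_norm_on K (\<lambda>x. wh x - w x) \<le> 1" for wh
      proof -
        obtain e where e: "0 \<le> e" "e \<le> 1" "sup_norm_on K (\<lambda>x. wh x - w x) = ennreal e"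
            "\<And>x. x \<in> K \<Longrightarrow> norm (wh x - w x) \<le> e"
          using sup_norm_on_le_1E[OF le1] by blast
        have "sup_norm_on K (\<lambda>x. limited U K wh x - w x)
            \<le> ennreal (C / \<bar>U (average_on K wh)\<bar> * e)"
          unfolding C_def
          using limited_error_bound[OF conv K M(2) _ _ B(2) U_max_pos[OF bdd[OF wh(1)] wh(2)]
              neg e(2,4)] M(1) assms(4)
          by (intro sup_norm_on_leI) (auto simp: sublevel_def)
        also have "\<dots> = ennreal (C / \<bar>U (average_on K wh)\<bar>) * sup_norm_on K (\<lambda>x. wh x - w x)"
          unfolding e(3) using \<open>0 < C\<close> e(1) by (intro ennreal_mult) auto
        finally show ?thesis .
      qed
      ultimately show ?thesis
        by blast
    next
      case False
      \<comment> \<open>A polynomial is bounded on bounded \<open>K\<close>, so closeness to it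
        would bound \<open>w\<close>. The estimate is then vacuous and any positive constant, such
        as 1, serves.\<close>
      have "\<not> sup_norm_on K (\<lambda>x. wh x - w x) \<le> 1" if wh: "polynomial_function wh" for wh
      proof
        assume "sup_norm_on K (\<lambda>x. wh x - w x) \<le> 1"
        then obtain e where e: "\<And>x. x \<in> K \<Longrightarrow> norm (wh x - w x) \<le> e"
          using sup_norm_on_le_1E by blast
        obtain b where b: "\<And>x. x \<in> K \<Longrightarrow> norm (wh x) \<le> b"
          using bounded_image_polynomial_function[OF wh bK] by (auto simp: bounded_iff)
        have "norm (w x) \<le> b + e" if "x \<in> K" for x
          using norm_triangle_sub[of "w x" "wh x"] b[OF that] e[OF that]
          by (simp add: norm_minus_commute)
        then show False
          using False by (auto simp: bounded_iff)
      qed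
      then show ?thesis
        by (intro exI[of _ 1]) auto
    qed
  qed
qed

end
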